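(* Let $p:\mathcal{E}\to\mathcal{B}$ be a fibration with codes (so $\mathcal B$ has binary products and a chosen terminal object $1$, and $p$ is a cloven fibration equipped with a code structure). Suppose that there exist an object $A\in\mathcal{B}$ and a morphism $i:\ulcorner\mathcal{E}_A\urcorner\to A$ in $\mathcal B$ such that the reindexing functor $i^*:\mathcal{E}_A\to\mathcal{E}_{\ulcorner\mathcal{E}_A\urcorner}$ is essentially surjective. Then, for any object $P\in\mathcal{E}_{\ulcorner\mathcal{E}_1\urcorner}$, there exists an object $X\in\mathcal{E}_1$ such that $P\cdot\ulcorner X\urcorner\cong X$ holds in $\mathcal{E}_1$.
   Context: For a cloven fibration $p:\mathcal E\to\mathcal B$ (a Grothendieck fibration with chosen Cartesian liftings), $\mathcal E_A$ is the fiber category over $A$, $f^*:\mathcal E_B\to\mathcal E_A$ is the reindexing functor along $f:A\to B$, and $X\cdot f$ means $f^*(X)$ (read $X\cdot f\cdot g$ as $(X\cdot f)\cdot g$). A global element $a\in_1 A$ is a morphism $a:1\to A$; for $f:A\to B$, $f(a)=f\circ a$, and $f(a,b)=f\circ\langle a,b\rangle$. Weak equality: for parallel $f,f':A\to B$ in $\mathcal B$ (with finite products), $f\approx f'$ means that the reindexing functors along $\langle \mathrm{id},f\rangle,\langle\mathrm{id},f'\rangle:A\to A\times B$ are naturally isomorphic. Code structure: let $p:\mathcal E\to\mathcal B$ be a cloven fibration over a category $\mathcal B$ with binary products and a chosen terminal object $1$. A code structure on $p$ consists of: (i) for each $A\in\mathcal B$ an object $\ulcorner\mathcal E_A\urcorner\in\mathcal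 B$, and for each $X\in\mathcal E_A$ a global element $\ulcorner X\urcorner\in_1\ulcorner\mathcal E_A\urcorner$; (ii) for each $A,B\in\mathcal B$ an object $\ulcorner\mathcal B(A,B)\urcorner\in\mathcal B$, and for each $f:A\to B$ a global element $\ulcorner f\urcorner\in_1\ulcorner\mathcal B(A,B)\urcorner$; (iii) for each $A,B\in\mathcal B$ a morphism $\mathsf{app}_{A,B}:\ulcorner\mathcal E_B\urcorner\times\ulcorner\mathcal B(A,B)\urcorner\to\ulcorner\mathcal E_A\urcorner$ such that $\mathsf{app}_{A,B}(\ulcorner X\urcorner,\ulcorner f\urcorner)\approx\ulcorner X\cdot f\urcorner$ for all $X\in\mathcal E_B$, $f:A\to B$; (iv) for each $A\in\mathcal B$ a morphism $\mathsf{code}_A:\ulcorner\mathcal E_A\urcorner\to\ulcorner\mathcal B(1,\ulcorner\mathcal E_A\urcorner)\urcorner$ such that $\mathsf{code}_A(\ulcorner X\urcorner)\approx\ulcorner\ulcorner X\urcorner\urcorner$ for all $X\in\mathcal E_A$ (the right-hand side is (ii) applied to the morphism $\ulcorner X\urcorner:1\to\ulcorner\mathcal E_A\urcorner$). A fibration with codes is a cloven fibration equipped with a code structure. *)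

theory Defs
  imports Main
begin

section \<open>Categories, functors, natural isomorphisms\<close>

record ('o, 'm) category_data =
  Obj :: "'o set"
  Arr :: "'m set"
  Dom :: "'m \<Rightarrow> 'o"
  Cod :: "'m \<Rightarrow> 'o"
  Ident :: "'o \<Rightarrow> 'm"
  Comp :: "'m \<Rightarrow> 'm \<Rightarrow> 'm" (infixl "\<odot>\<index>" 70)

text \<open>Composition is written in applicative order: \<open>g \<odot>\<^bsub>C\<^esub> f\<close> is \<open>g\<close> after \<open>f\<close>.\<close>

definition hom :: "('o, 'm) category_data \<Rightarrow> 'o \<Rightarrow> 'o \<Rightarrow> 'm set" where
  "hom C A B = {f \<in> Arr C. Dom C f = A \<and> Cod C f = B}"

locale category =
  fixes C :: "('o, 'm) category_data" (structure)
  assumes Dom_Obj: "f \<in> Arr C \<Longrightarrow> Dom C f \<in> Obj C"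
    and Cod_Obj: "f \<in> Arr C \<Longrightarrow> Cod C f \<in> Obj C"
    and Ident_hom: "A \<in> Obj C \<Longrightarrow> Ident C A \<in> hom C A A"
    and Comp_hom: "f \<in> hom C A B \<Longrightarrow> g \<in> hom C B D \<Longrightarrow> g \<odot> f \<in> hom C A D"
    and Comp_Ident_left: "f \<in> hom C A B \<Longrightarrow> Ident C B \<odot> f = f"
    and Comp_Ident_right: "f \<in> hom C A B \<Longrightarrow> f \<odot> Ident C A = f"
    and Comp_assoc:
      "f \<in> hom C A B \<Longrightarrow> g \<in> hom C B D \<Longrightarrow> h \<in> hom C D E \<Longrightarrow>
        (h \<odot> g) \<odot> f = h \<odot> (g \<odot> f)"

definition iso_in :: "('o, 'm) category_data \<Rightarrow> 'o \<Rightarrow> 'o \<Rightarrow> 'm \<Rightarrow> bool" where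
  "iso_in C A B f \<longleftrightarrow> f \<in> hom C A B \<and>
    (\<exists>g \<in> hom C B A. g \<odot>\<^bsub>C\<^esub> f = Ident C A \<and> f \<odot>\<^bsub>C\<^esub> g = Ident C B)"

definition isomorphic :: "('o, 'm) category_data \<Rightarrow> 'o \<Rightarrow> 'o \<Rightarrow> bool" where
  "isomorphic C A B \<longleftrightarrow> (\<exists>f. iso_in C A B f)"

record ('o1, 'm1, 'o2, 'm2) functor_data =
  ObjMap :: "'o1 \<Rightarrow> 'o2"
  ArrMap :: "'m1 \<Rightarrow> 'm2"

locale category_functor = source: category C + target: category D
  for C :: "('o1, 'm1) category_data"
    and D :: "('o2, 'm2) category_data"
    and F :: "('o1, 'm1, 'o2, 'm2) functor_data" +
  assumes ObjMap_Obj: "X \<in> Obj C \<Longrightarrow> ObjMap F X \<in> Obj D"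
    and ArrMap_hom: "u \<in> hom C X Y \<Longrightarrow> ArrMap F u \<in> hom D (ObjMap F X) (ObjMap F Y)"
    and ArrMap_Ident: "X \<in> Obj C \<Longrightarrow> ArrMap F (Ident C X) = Ident D (ObjMap F X)"
    and ArrMap_Comp:
      "u \<in> hom C X Y \<Longrightarrow> v \<in> hom C Y Z \<Longrightarrow>
        ArrMap F (v \<odot>\<^bsub>C\<^esub> u) = ArrMap F v \<odot>\<^bsub>D\<^esub> ArrMap F u"

definition naturally_isomorphic ::
  "('o1, 'm1) category_data \<Rightarrow> ('o2, 'm2) category_data \<Rightarrow>
    ('o1, 'm1, 'o2, 'm2) functor_data \<Rightarrow> ('o1, 'm1, 'o2, 'm2) functor_data \<Rightarrow> bool" where
  "naturally_isomorphic C D F G \<longleftrightarrow>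
    (\<exists>\<eta>. (\<forall>X \<in> Obj C. iso_in D (ObjMap F X) (ObjMap G X) (\<eta> X)) \<and>
         (\<forall>X \<in> Obj C. \<forall>Y \<in> Obj C. \<forall>u \<in> hom C X Y.
            \<eta> Y \<odot>\<^bsub>D\<^esub> ArrMap F u = ArrMap G u \<odot>\<^bsub>D\<^esub> \<eta> X))"

definition essentially_surjective ::
  "('o1, 'm1) category_data \<Rightarrow> ('o2, 'm2) category_data \<Rightarrow>
    ('o1, 'm1, 'o2, 'm2) functor_data \<Rightarrow> bool" where
  "essentially_surjective C D F \<longleftrightarrow>
    (\<forall>Y \<in> Obj D. \<exists>X \<in> Obj C. isomorphic D (ObjMap F X) Y)"


section \<open>Binary products and a terminal object\<close>

record ('o, 'm) products_data =
  One :: "'o"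
  Prod :: "'o \<Rightarrow> 'o \<Rightarrow> 'o"
  Proj1 :: "'o \<Rightarrow> 'o \<Rightarrow> 'm"
  Proj2 :: "'o \<Rightarrow> 'o \<Rightarrow> 'm"

locale category_with_products = category C
  for C :: "('o, 'm) category_data" and Q :: "('o, 'm) products_data" +
  assumes One_Obj: "One Q \<in> Obj C"
    and One_terminal: "A \<in> Obj C \<Longrightarrow> \<exists>!f. f \<in> hom C A (One Q)"
    and Prod_Obj: "A \<in> Obj C \<Longrightarrow> B \<in> Obj C \<Longrightarrow> Prod Q A B \<in> Obj C"
    and Proj1_hom: "A \<in> Obj C \<Longrightarrow> B \<in> Obj C \<Longrightarrow> Proj1 Q A B \<in> hom C (Prod Q A B) A"
    and Proj2_hom: "A \<in> Obj C \<Longrightarrow> B \<in> Obj C \<Longrightarrow> Proj2 Q A B \<in> hom C (Prod Q A B) B"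
    and Prod_universal:
      "f \<in> hom C D A \<Longrightarrow> g \<in> hom C D B \<Longrightarrow>
        \<exists>!h. h \<in> hom C D (Prod Q A B) \<and>
             Proj1 Q A B \<odot>\<^bsub>C\<^esub> h = f \<and> Proj2 Q A B \<odot>\<^bsub>C\<^esub> h = g"

definition pairing ::
  "('o, 'm) category_data \<Rightarrow> ('o, 'm) products_data \<Rightarrow> 'm \<Rightarrow> 'm \<Rightarrow> 'm" where
  "pairing C Q f g =
    (THE h. h \<in> hom C (Dom C f) (Prod Q (Cod C f) (Cod C g)) \<and>
            Proj1 Q (Cod C f) (Cod C g) \<odot>\<^bsub>C\<^esub> h = f \<and>
            Proj2 Q (Cod C f) (Cod C g) \<odot>\<^bsub>C\<^esub> h = g)"


section \<open>Cloven fibrations\<close>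

text \<open>\<open>Lift p f X\<close> is the chosen Cartesian arrow over \<open>f\<close> with codomain \<open>X\<close>.
  The cleavage is neither normalized nor split.\<close>

record ('e, 'a, 'o, 'm) fibration_data =
  Total :: "('e, 'a) category_data"
  Base :: "('o, 'm) category_data"
  Projection :: "('e, 'a, 'o, 'm) functor_data"
  Lift :: "'m \<Rightarrow> 'e \<Rightarrow> 'a"

definition cartesian :: "('e, 'a, 'o, 'm) fibration_data \<Rightarrow> 'a \<Rightarrow> bool" where
  "cartesian p u \<longleftrightarrow> u \<in> Arr (Total p) \<and>
    (\<forall>v \<in> Arr (Total p). \<forall>g.
       Cod (Total p) v = Cod (Total p) u \<and>
       g \<in> hom (Base p) (ObjMap (Projection p) (Dom (Total p) v))
                        (ObjMap (Projection p) (Dom (Total p) u)) \<and>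
       ArrMap (Projection p) u \<odot>\<^bsub>Base p\<^esub> g = ArrMap (Projection p) v \<longrightarrow>
       (\<exists>!w. w \<in> hom (Total p) (Dom (Total p) v) (Dom (Total p) u) \<and>
             ArrMap (Projection p) w = g \<and> u \<odot>\<^bsub>Total p\<^esub> w = v))"

locale cloven_fibration =
  category_functor "Total p" "Base p" "Projection p"
  for p :: "('e, 'a, 'o, 'm) fibration_data" +
  assumes Lift_over:
      "f \<in> hom (Base p) A B \<Longrightarrow> X \<in> Obj (Total p) \<Longrightarrow> ObjMap (Projection p) X = B \<Longrightarrow>
        Lift p f X \<in> Arr (Total p) \<and> Cod (Total p) (Lift p f X) = X \<and>
        ArrMap (Projection p) (Lift p f X) = f"
    and Lift_cartesian:
      "f \<in> hom (Base p) A B \<Longrightarrow> X \<in> Obj (Total p) \<Longrightarrow> ObjMap (Projection p) X = B \<Longrightarrow>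
        cartesian p (Lift p f X)"

definition fiber ::
  "('e, 'a, 'o, 'm) fibration_data \<Rightarrow> 'o \<Rightarrow> ('e, 'a) category_data" where
  "fiber p A =
    \<lparr> Obj = {X \<in> Obj (Total p). ObjMap (Projection p) X = A},
      Arr = {u \<in> Arr (Total p). ArrMap (Projection p) u = Ident (Base p) A},
      Dom = Dom (Total p),
      Cod = Cod (Total p),
      Ident = Ident (Total p),
      Comp = Comp (Total p) \<rparr>"

text \<open>\<open>reindex p f\<close> is \<open>f\<^sup>*\<close>. On an arrow \<open>u : X \<rightarrow> Y\<close> of the fiber over the codomain of \<open>f\<close>
  it is the vertical arrow induced by Cartesianness of \<open>Lift p f Y\<close>.\<close>

definition reindex ::
  "('e, 'a, 'o, 'm) fibration_data \<Rightarrow> 'm \<Rightarrow> ('e, 'a, 'e, 'a) functor_data" where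
  "reindex p f =
    \<lparr> ObjMap = (\<lambda>X. Dom (Total p) (Lift p f X)),
      ArrMap = (\<lambda>u.
        let X = Dom (Total p) u; Y = Cod (Total p) u in
        THE w. w \<in> hom (fiber p (Dom (Base p) f))
                       (Dom (Total p) (Lift p f X)) (Dom (Total p) (Lift p f Y)) \<and>
               Lift p f Y \<odot>\<^bsub>Total p\<^esub> w = u \<odot>\<^bsub>Total p\<^esub> Lift p f X) \<rparr>"


section \<open>Weak equality and code structures\<close>

definition weakly_equal ::
  "('e, 'a, 'o, 'm) fibration_data \<Rightarrow> ('o, 'm) products_data \<Rightarrow> 'm \<Rightarrow> 'm \<Rightarrow> bool" where
  "weakly_equal p Q f f' \<longleftrightarrow>
    (\<exists>A B. f \<in> hom (Base p) A B \<and> f' \<in> hom (Base p) A B \<and>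
      naturally_isomorphic (fiber p (Prod Q A B)) (fiber p A)
        (reindex p (pairing (Base p) Q (Ident (Base p) A) f))
        (reindex p (pairing (Base p) Q (Ident (Base p) A) f')))"

text \<open>\<open>CodeFib K A\<close> and \<open>CodeHom K A B\<close> are the objects of codes for \<open>\<E>\<^sub>A\<close> and \<open>\<B>(A,B)\<close>;
  \<open>QuoteObj K X\<close> and \<open>QuoteArr K f\<close> are the global elements coding \<open>X\<close> and \<open>f\<close>.
  The indices of the latter two are determined by \<open>X\<close> and \<open>f\<close>.\<close>

record ('e, 'o, 'm) code_data =
  CodeFib :: "'o \<Rightarrow> 'o"
  QuoteObj :: "'e \<Rightarrow> 'm"
  CodeHom :: "'o \<Rightarrow> 'o \<Rightarrow> 'o"
  QuoteArr :: "'m \<Rightarrow> 'm"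
  App :: "'o \<Rightarrow> 'o \<Rightarrow> 'm"
  Code :: "'o \<Rightarrow> 'm"

locale fibration_with_codes =
  cloven_fibration p + category_with_products "Base p" Q
  for p :: "('e, 'a, 'o, 'm) fibration_data"
    and Q :: "('o, 'm) products_data"
    and K :: "('e, 'o, 'm) code_data" +
  assumes CodeFib_Obj: "A \<in> Obj (Base p) \<Longrightarrow> CodeFib K A \<in> Obj (Base p)"
    and QuoteObj_hom:
      "A \<in> Obj (Base p) \<Longrightarrow> X \<in> Obj (fiber p A) \<Longrightarrow>
        QuoteObj K X \<in> hom (Base p) (One Q) (CodeFib K A)"
    and CodeHom_Obj:
      "A \<in> Obj (Base p) \<Longrightarrow> B \<in> Obj (Base p) \<Longrightarrow> CodeHom K A B \<in> Obj (Base p)"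
    and QuoteArr_hom:
      "f \<in> hom (Base p) A B \<Longrightarrow> QuoteArr K f \<in> hom (Base p) (One Q) (CodeHom K A B)"
    and App_hom:
      "A \<in> Obj (Base p) \<Longrightarrow> B \<in> Obj (Base p) \<Longrightarrow>
        App K A B \<in> hom (Base p) (Prod Q (CodeFib K B) (CodeHom K A B)) (CodeFib K A)"
    and App_weak:
      "f \<in> hom (Base p) A B \<Longrightarrow> X \<in> Obj (fiber p B) \<Longrightarrow>
        weakly_equal p Q
          (App K A B \<odot>\<^bsub>Base p\<^esub> pairing (Base p) Q (QuoteObj K X) (QuoteArr K f))
          (QuoteObj K (ObjMap (reindex p f) X))"
    and Code_hom:
      "A \<in> Obj (Base p) \<Longrightarrow>
        Code K A \<in> hom (Base p) (CodeFib K A) (CodeHom K (One Q) (CodeFib K A))"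
    and Code_weak:
      "A \<in> Obj (Base p) \<Longrightarrow> X \<in> Obj (fiber p A) \<Longrightarrow>
        weakly_equal p Q
          (Code K A \<odot>\<^bsub>Base p\<^esub> QuoteObj K X)
          (QuoteArr K (QuoteObj K X))"

end

(* Only the following consequence of weak equality is needed: f and f' reindex every object to
   isomorphic objects. On global elements this relation is compatible with composition and
   pairing, because a pair of global elements is the image of either component under a morphism.
   The argument is then Lawvere's diagonal argument. Let d be the morphism from the codes of E_A
   to the codes of E_1 given by d(x) = app(app(x, <i>), code(x)), where <i> is the code of i, so
   that d(<G>) is indistinguishable from <G . i . <G>>. Choose G with G . i isomorphic to P . d
   and put X = G . i . <G>; then X = P . d . <G> = P . <X> up to isomorphism. *)

theory Submission
  imports Defs
begin

section \<open>Isomorphism of objects as an equivalence relation\<close>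

lemma hom_iff: "f \<in> hom C A B \<longleftrightarrow> f \<in> Arr C \<and> Dom C f = A \<and> Cod C f = B"
  by (simp add: hom_def)

context category
begin

lemma hom_Obj: "f \<in> hom C A B \<Longrightarrow> A \<in> Obj C" "f \<in> hom C A B \<Longrightarrow> B \<in> Obj C"
  using Dom_Obj Cod_Obj by (auto simp: hom_def)

lemma isomorphic_sym: "isomorphic C A B \<Longrightarrow> isomorphic C B A"
  unfolding isomorphic_def iso_in_def by blast

lemma isomorphic_trans:
  assumes "isomorphic C A B" "isomorphic C B D"
  shows "isomorphic C A D"
proof -
  obtain f g where f: "f \<in> hom C A B" "g \<in> hom C B A" "g \<odot> f = Ident C A" "f \<odot> g = Ident C B"
    using assms(1) unfolding isomorphic_def iso_in_def by blast
  obtain h k where h: "h \<in> hom C B D" "k \<in> hom C D B" "k \<odot> h = Ident C B" "h \<odot> k = Ident C D"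
    using assms(2) unfolding isomorphic_def iso_in_def by blast
  have hf: "h \<odot> f \<in> hom C A D" and gk: "g \<odot> k \<in> hom C D A"
    using f h Comp_hom by blast+
  have "(g \<odot> k) \<odot> (h \<odot> f) = g \<odot> ((k \<odot> h) \<odot> f)"
    using Comp_assoc[OF hf h(2) f(2)] Comp_assoc[OF f(1) h(1,2)] by simp
  then have 1: "(g \<odot> k) \<odot> (h \<odot> f) = Ident C A"
    using f h Comp_Ident_left by simp
  have "(h \<odot> f) \<odot> (g \<odot> k) = h \<odot> ((f \<odot> g) \<odot> k)"
    using Comp_assoc[OF gk f(1) h(1)] Comp_assoc[OF h(2) f(2,1)] by simp
  then have 2: "(h \<odot> f) \<odot> (g \<odot> k) = Ident C D"
    using f h Comp_Ident_left by simp
  show ?thesis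
    unfolding isomorphic_def iso_in_def using hf gk 1 2 by blast
qed

end

section \<open>Pairing, constant morphisms and global elements\<close>

context category_with_products
begin

lemma pairing_props:
  assumes "f \<in> hom C D A" "g \<in> hom C D B"
  shows "pairing C Q f g \<in> hom C D (Prod Q A B)"
    and "Proj1 Q A B \<odot>\<^bsub>C\<^esub> pairing C Q f g = f"
    and "Proj2 Q A B \<odot>\<^bsub>C\<^esub> pairing C Q f g = g"
proof -
  have "Dom C f = D" "Cod C f = A" "Cod C g = B"
    using assms by (auto simp: hom_def)
  then show "pairing C Q f g \<in> hom C D (Prod Q A B)"
    and "Proj1 Q A B \<odot>\<^bsub>C\<^esub> pairing C Q f g = f" and "Proj2 Q A B \<odot>\<^bsub>C\<^esub> pairing C Q f g = g"
    using theI'[OF Prod_universal[OF assms]] by (simp_all add: pairing_def)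
qed

text \<open>Both sides have the same two projections, so uniqueness in the universal property of the
  product identifies them.\<close>

lemma pairing_Comp:
  assumes f: "f \<in> hom C D A" and g: "g \<in> hom C D B" and k: "k \<in> hom C E D"
  shows "pairing C Q f g \<odot>\<^bsub>C\<^esub> k = pairing C Q (f \<odot>\<^bsub>C\<^esub> k) (g \<odot>\<^bsub>C\<^esub> k)"
proof -
  have fk: "f \<odot>\<^bsub>C\<^esub> k \<in> hom C E A" and gk: "g \<odot>\<^bsub>C\<^esub> k \<in> hom C E B"
    using assms Comp_hom by blast+
  have A: "A \<in> Obj C" and B: "B \<in> Obj C"
    using f g hom_Obj by blast+
  note fg = pairing_props[OF f g]
  have "pairing C Q f g \<odot>\<^bsub>C\<^esub> k \<in> hom C E (Prod Q A B)"
    using fg k Comp_hom by blast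
  moreover have "Proj1 Q A B \<odot>\<^bsub>C\<^esub> (pairing C Q f g \<odot>\<^bsub>C\<^esub> k) = f \<odot>\<^bsub>C\<^esub> k"
    "Proj2 Q A B \<odot>\<^bsub>C\<^esub> (pairing C Q f g \<odot>\<^bsub>C\<^esub> k) = g \<odot>\<^bsub>C\<^esub> k"
    using Comp_assoc[OF k fg(1) Proj1_hom[OF A B]] Comp_assoc[OF k fg(1) Proj2_hom[OF A B]] fg
    by simp_all
  ultimately show ?thesis
    using Prod_universal[OF fk gk] pairing_props[OF fk gk] by blast
qed

definition terminal_arr where
  "terminal_arr A = (THE f. f \<in> hom C A (One Q))"

lemma terminal_arr_hom: "A \<in> Obj C \<Longrightarrow> terminal_arr A \<in> hom C A (One Q)"
  unfolding terminal_arr_def by (rule theI'[OF One_terminal])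

text \<open>\<open>f \<odot> terminal_arr A\<close> is the constant morphism at \<open>f\<close>.
  Evaluating it at \<open>a\<close> returns \<open>f\<close> because the only endomorphism of
  \<open>One Q\<close> is the identity.\<close>

lemma const_Comp_global:
  assumes a: "a \<in> hom C (One Q) A" and f: "f \<in> hom C (One Q) B"
  shows "(f \<odot>\<^bsub>C\<^esub> terminal_arr A) \<odot>\<^bsub>C\<^esub> a = f"
proof -
  have t: "terminal_arr A \<in> hom C A (One Q)"
    using a hom_Obj terminal_arr_hom by blast
  have "terminal_arr A \<odot>\<^bsub>C\<^esub> a = Ident C (One Q)"
    using Comp_hom[OF a t] Ident_hom[OF One_Obj] One_terminal[OF One_Obj] by blast
  then show ?thesis
    using Comp_assoc[OF a t f] Comp_Ident_right[OF f] by simp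
qed

text \<open>Presents the pair as the image of \<open>a\<close> under a morphism built from
  \<open>b\<close> alone. A relation stable under postcomposition may therefore be applied in the
  first component while the second stays fixed.\<close>

lemma pairing_factor_left:
  assumes a: "a \<in> hom C (One Q) A" and b: "b \<in> hom C (One Q) B"
  shows "pairing C Q (Ident C A) (b \<odot>\<^bsub>C\<^esub> terminal_arr A) \<odot>\<^bsub>C\<^esub> a = pairing C Q a b"
    and "pairing C Q (Ident C A) (b \<odot>\<^bsub>C\<^esub> terminal_arr A) \<in> hom C A (Prod Q A B)"
proof -
  have A: "A \<in> Obj C" using a hom_Obj by blast
  have c: "b \<odot>\<^bsub>C\<^esub> terminal_arr A \<in> hom C A B"
    using Comp_hom[OF terminal_arr_hom[OF A] b] .
  show "pairing C Q (Ident C A) (b \<odot>\<^bsub>C\<^esub> terminal_arr A) \<in> hom C A (Prod Q A B)"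
    using pairing_props(1)[OF Ident_hom[OF A] c] .
  show "pairing C Q (Ident C A) (b \<odot>\<^bsub>C\<^esub> terminal_arr A) \<odot>\<^bsub>C\<^esub> a = pairing C Q a b"
    using pairing_Comp[OF Ident_hom[OF A] c a] const_Comp_global[OF a b] Comp_Ident_left[OF a]
    by simp
qed

lemma pairing_factor_right:
  assumes a: "a \<in> hom C (One Q) A" and b: "b \<in> hom C (One Q) B"
  shows "pairing C Q (a \<odot>\<^bsub>C\<^esub> terminal_arr B) (Ident C B) \<odot>\<^bsub>C\<^esub> b = pairing C Q a b"
    and "pairing C Q (a \<odot>\<^bsub>C\<^esub> terminal_arr B) (Ident C B) \<in> hom C B (Prod Q A B)"
proof -
  have B: "B \<in> Obj C" using b hom_Obj by blast
  have c: "a \<odot>\<^bsub>C\<^esub> terminal_arr B \<in> hom C B A"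
    using Comp_hom[OF terminal_arr_hom[OF B] a] .
  show "pairing C Q (a \<odot>\<^bsub>C\<^esub> terminal_arr B) (Ident C B) \<in> hom C B (Prod Q A B)"
    using pairing_props(1)[OF c Ident_hom[OF B]] .
  show "pairing C Q (a \<odot>\<^bsub>C\<^esub> terminal_arr B) (Ident C B) \<odot>\<^bsub>C\<^esub> b = pairing C Q a b"
    using pairing_Comp[OF c Ident_hom[OF B] b] const_Comp_global[OF b a] Comp_Ident_left[OF b]
    by simp
qed

end

section \<open>Fibers, Cartesian arrows and reindexing up to isomorphism\<close>

context cloven_fibration
begin

abbreviation comp_total (infixl "\<cdot>" 70) where
  "g \<cdot> f \<equiv> Comp (Total p) g f"

abbreviation comp_base (infixl "\<circ>\<^sub>B" 70) where
  "g \<circ>\<^sub>B f \<equiv> Comp (Base p) g f"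

abbreviation pr where "pr \<equiv> ArrMap (Projection p)"
abbreviation pob where "pob \<equiv> ObjMap (Projection p)"

abbreviation pullback where "pullback f X \<equiv> ObjMap (reindex p f) X"

lemma fiber_hom_iff:
  "u \<in> hom (fiber p A) X Y \<longleftrightarrow> u \<in> hom (Total p) X Y \<and> pr u = Ident (Base p) A"
  by (auto simp: hom_def fiber_def)

lemma fiber_simps:
  "X \<in> Obj (fiber p A) \<longleftrightarrow> X \<in> Obj (Total p) \<and> pob X = A"
  "Ident (fiber p A) = Ident (Total p)"
  "Comp (fiber p A) = Comp (Total p)"
  by (simp_all add: fiber_def)

text \<open>Arrows of a fiber are selected only by lying over an identity. That their end points
  belong to the fiber is recovered from the domain and codomain of that identity.\<close>

lemma vertical_over:
  assumes A: "A \<in> Obj (Base p)" and u: "u \<in> hom (Total p) X Y" and pu: "pr u = Ident (Base p) A"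
  shows "pob X = A" "pob Y = A"
  using ArrMap_hom[OF u] target.Ident_hom[OF A] pu by (auto simp: hom_def)

lemma fiber_category:
  assumes A: "A \<in> Obj (Base p)"
  shows "category (fiber p A)"
proof
  fix f assume "f \<in> Arr (fiber p A)"
  then have f: "f \<in> hom (Total p) (Dom (Total p) f) (Cod (Total p) f)" "pr f = Ident (Base p) A"
    by (auto simp: hom_def fiber_def)
  show "Dom (fiber p A) f \<in> Obj (fiber p A)" "Cod (fiber p A) f \<in> Obj (fiber p A)"
    using vertical_over[OF A f] source.hom_Obj[OF f(1)] by (auto simp: fiber_def)
next
  fix X assume "X \<in> Obj (fiber p A)"
  then show "Ident (fiber p A) X \<in> hom (fiber p A) X X"
    using source.Ident_hom ArrMap_Ident by (auto simp: fiber_hom_iff fiber_simps)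
next
  fix f g X Y Z assume "f \<in> hom (fiber p A) X Y" "g \<in> hom (fiber p A) Y Z"
  then show "Comp (fiber p A) g f \<in> hom (fiber p A) X Z"
    using source.Comp_hom ArrMap_Comp target.Comp_Ident_left[OF target.Ident_hom[OF A]]
    by (auto simp: fiber_hom_iff fiber_simps)
qed (auto simp: fiber_hom_iff fiber_simps source.Comp_Ident_left source.Comp_Ident_right
      intro: source.Comp_assoc)

text \<open>Together with the introduction rule below, this trades the \<open>Dom\<close> and
  \<open>Cod\<close> terms of \<open>cartesian\<close> for hom-sets with named end points.\<close>

lemma cartesianD:
  assumes "cartesian p u" "u \<in> hom (Total p) X Y" "v \<in> hom (Total p) Z Y"
    "g \<in> hom (Base p) (pob Z) (pob X)" "pr u \<circ>\<^sub>B g = pr v"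
  shows "\<exists>!w. w \<in> hom (Total p) Z X \<and> pr w = g \<and> u \<cdot> w = v"
proof -
  have "u \<in> Arr (Total p)" "Dom (Total p) u = X" "Cod (Total p) u = Y"
    "v \<in> Arr (Total p)" "Dom (Total p) v = Z" "Cod (Total p) v = Y"
    using assms by (auto simp: hom_iff)
  then show ?thesis
    using assms(1)[unfolded cartesian_def, THEN conjunct2, rule_format, of v g] assms(4,5) by simp
qed

lemma cartesianI:
  assumes "u \<in> hom (Total p) X Y"
    and "\<And>v Z g. \<lbrakk>v \<in> hom (Total p) Z Y; g \<in> hom (Base p) (pob Z) (pob X); pr u \<circ>\<^sub>B g = pr v\<rbrakk>
      \<Longrightarrow> \<exists>!w. w \<in> hom (Total p) Z X \<and> pr w = g \<and> u \<cdot> w = v"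
  shows "cartesian p u"
  unfolding cartesian_def
proof (intro conjI ballI allI impI)
  have u: "u \<in> Arr (Total p)" "Dom (Total p) u = X" "Cod (Total p) u = Y"
    using assms(1) by (auto simp: hom_iff)
  then show "u \<in> Arr (Total p)" by simp
  fix v g
  assume "v \<in> Arr (Total p)" and *: "Cod (Total p) v = Cod (Total p) u \<and>
    g \<in> hom (Base p) (pob (Dom (Total p) v)) (pob (Dom (Total p) u)) \<and> pr u \<circ>\<^sub>B g = pr v"
  then have "v \<in> hom (Total p) (Dom (Total p) v) Y"
    using u by (simp add: hom_iff)
  then show "\<exists>!w. w \<in> hom (Total p) (Dom (Total p) v) (Dom (Total p) u) \<and> pr w = g \<and> u \<cdot> w = v"
    using assms(2) * u by simp
qed

text \<open>An arrow into \<open>Z\<close> is factored in two stages, first through \<open>u\<close>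
  and then through \<open>v\<close>; uniqueness is also obtained stage by stage.\<close>

lemma cartesian_Comp:
  assumes cu: "cartesian p u" and cv: "cartesian p v"
    and u: "u \<in> hom (Total p) Y Z" and v: "v \<in> hom (Total p) X Y"
  shows "cartesian p (u \<cdot> v)"
proof (rule cartesianI)
  show uv: "u \<cdot> v \<in> hom (Total p) X Z"
    using source.Comp_hom[OF v u] .
  fix t W g
  assume t: "t \<in> hom (Total p) W Z" and g: "g \<in> hom (Base p) (pob W) (pob X)"
    and eq: "pr (u \<cdot> v) \<circ>\<^sub>B g = pr t"
  have pu: "pr u \<in> hom (Base p) (pob Y) (pob Z)" and pv: "pr v \<in> hom (Base p) (pob X) (pob Y)"
    using u v ArrMap_hom by blast+
  have vg: "pr v \<circ>\<^sub>B g \<in> hom (Base p) (pob W) (pob Y)"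
    using target.Comp_hom[OF g pv] .
  have "pr u \<circ>\<^sub>B (pr v \<circ>\<^sub>B g) = pr t"
    using eq ArrMap_Comp[OF v u] target.Comp_assoc[OF g pv pu] by simp
  from cartesianD[OF cu u t vg this] obtain w1 where
    w1: "w1 \<in> hom (Total p) W Y" "pr w1 = pr v \<circ>\<^sub>B g" "u \<cdot> w1 = t"
    and uniq1: "\<And>w. w \<in> hom (Total p) W Y \<Longrightarrow> pr w = pr v \<circ>\<^sub>B g \<Longrightarrow> u \<cdot> w = t \<Longrightarrow> w = w1"
    by blast
  \<comment> \<open>\<open>w1\<close> was chosen over \<open>pr v \<circ>\<^sub>B g\<close>, which
    is exactly the condition for factoring it through \<open>v\<close> over
    \<open>g\<close>.\<close>
  from cartesianD[OF cv v w1(1) g w1(2)[symmetric]] obtain w2 where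
    w2: "w2 \<in> hom (Total p) W X" "pr w2 = g" "v \<cdot> w2 = w1"
    and uniq2: "\<And>w. w \<in> hom (Total p) W X \<Longrightarrow> pr w = g \<Longrightarrow> v \<cdot> w = w1 \<Longrightarrow> w = w2"
    by blast
  show "\<exists>!w. w \<in> hom (Total p) W X \<and> pr w = g \<and> (u \<cdot> v) \<cdot> w = t"
  proof (rule ex1I[of _ w2])
    show "w2 \<in> hom (Total p) W X \<and> pr w2 = g \<and> (u \<cdot> v) \<cdot> w2 = t"
      using w2 w1 source.Comp_assoc[OF w2(1) v u] by simp
  next
    fix w assume w: "w \<in> hom (Total p) W X \<and> pr w = g \<and> (u \<cdot> v) \<cdot> w = t"
    then have wh: "w \<in> hom (Total p) W X" by simp
    have "v \<cdot> w = w1"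
      using w uniq1[OF source.Comp_hom[OF wh v]] ArrMap_Comp[OF wh v] source.Comp_assoc[OF wh v u]
      by simp
    then show "w = w2"
      using w uniq2 by blast
  qed
qed

text \<open>Since \<open>u\<close> lies over an identity, \<open>g\<close> must equal
  \<open>pr v\<close>, and composing with the inverse of \<open>u\<close> gives the one possible
  factorization.\<close>

lemma fiber_iso_cartesian:
  assumes A: "A \<in> Obj (Base p)" and iso: "iso_in (fiber p A) X Y u"
  shows "cartesian p u"
proof -
  obtain u' where u: "u \<in> hom (Total p) X Y" "pr u = Ident (Base p) A"
    and u': "u' \<in> hom (Total p) Y X" "pr u' = Ident (Base p) A"
    and inv: "u' \<cdot> u = Ident (Total p) X" "u \<cdot> u' = Ident (Total p) Y"
    using iso unfolding iso_in_def Bex_def fiber_hom_iff fiber_simps by blast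
  note over = vertical_over[OF A u]
  show ?thesis
  proof (rule cartesianI[OF u(1)])
    fix v Z g
    assume v: "v \<in> hom (Total p) Z Y" and g: "g \<in> hom (Base p) (pob Z) (pob X)"
      and eq: "pr u \<circ>\<^sub>B g = pr v"
    have gv: "g = pr v"
      using eq g target.Comp_Ident_left u over by simp
    show "\<exists>!w. w \<in> hom (Total p) Z X \<and> pr w = g \<and> u \<cdot> w = v"
    proof (rule ex1I[of _ "u' \<cdot> v"])
      show "u' \<cdot> v \<in> hom (Total p) Z X \<and> pr (u' \<cdot> v) = g \<and> u \<cdot> (u' \<cdot> v) = v"
        using source.Comp_hom[OF v u'(1)] ArrMap_Comp[OF v u'(1)] source.Comp_assoc[OF v u'(1) u(1)]
          source.Comp_Ident_left[OF v] target.Comp_Ident_left ArrMap_hom[OF v] inv u' over gv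
        by simp
    next
      fix w assume w: "w \<in> hom (Total p) Z X \<and> pr w = g \<and> u \<cdot> w = v"
      then show "w = u' \<cdot> v"
        using source.Comp_assoc[of w Z X u Y u' X] source.Comp_Ident_left[of w Z X] u u' inv by simp
    qed
  qed
qed

text \<open>Cartesian liftings are unique up to vertical isomorphism. Every comparison of reindexed
  objects below is reduced to this fact, so functoriality of \<open>reindex\<close> is never
  invoked.\<close>

lemma cartesian_domains_isomorphic:
  assumes cu: "cartesian p u" and cv: "cartesian p v"
    and u: "u \<in> hom (Total p) X Z" and v: "v \<in> hom (Total p) Y Z"
    and f: "f \<in> hom (Base p) A B" "pr u = f" "pr v = f"
  shows "isomorphic (fiber p A) X Y"
proof -
  have over: "pob X = A" "pob Y = A"
    using ArrMap_hom[OF u] ArrMap_hom[OF v] f by (auto simp: hom_def)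
  have X: "X \<in> Obj (Total p)" and Y: "Y \<in> Obj (Total p)"
    using u v source.hom_Obj by blast+
  have A: "A \<in> Obj (Base p)"
    using f target.hom_Obj by blast
  note I = target.Ident_hom[OF A]
  have fI: "f \<circ>\<^sub>B Ident (Base p) A = f"
    using target.Comp_Ident_right[OF f(1)] .
  obtain a where a: "a \<in> hom (Total p) X Y" "pr a = Ident (Base p) A" "v \<cdot> a = u"
    using cartesianD[OF cv v u, of "Ident (Base p) A"] I fI f over by auto
  obtain b where b: "b \<in> hom (Total p) Y X" "pr b = Ident (Base p) A" "u \<cdot> b = v"
    using cartesianD[OF cu u v, of "Ident (Base p) A"] I fI f over by auto
  \<comment> \<open>\<open>b \<cdot> a\<close> and the identity are both vertical factorizations of
    \<open>u\<close> through itself, so they coincide; the same holds for \<open>a \<cdot> b\<close>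
    and \<open>v\<close>.\<close>
  have "b \<cdot> a \<in> hom (Total p) X X \<and> pr (b \<cdot> a) = Ident (Base p) A \<and> u \<cdot> (b \<cdot> a) = u"
    using source.Comp_hom[OF a(1) b(1)] ArrMap_Comp[OF a(1) b(1)] source.Comp_assoc[OF a(1) b(1) u]
      a b target.Comp_Ident_left[OF I] by simp
  moreover have "Ident (Total p) X \<in> hom (Total p) X X \<and> pr (Ident (Total p) X) = Ident (Base p) A
      \<and> u \<cdot> Ident (Total p) X = u"
    using source.Ident_hom[OF X] ArrMap_Ident[OF X] source.Comp_Ident_right[OF u] over by simp
  ultimately have ba: "b \<cdot> a = Ident (Total p) X"
    using cartesianD[OF cu u u, of "Ident (Base p) A"] I fI f over by auto
  have "a \<cdot> b \<in> hom (Total p) Y Y \<and> pr (a \<cdot> b) = Ident (Base p) A \<and> v \<cdot> (a \<cdot> b) = v"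
    using source.Comp_hom[OF b(1) a(1)] ArrMap_Comp[OF b(1) a(1)] source.Comp_assoc[OF b(1) a(1) v]
      a b target.Comp_Ident_left[OF I] by simp
  moreover have "Ident (Total p) Y \<in> hom (Total p) Y Y \<and> pr (Ident (Total p) Y) = Ident (Base p) A
      \<and> v \<cdot> Ident (Total p) Y = v"
    using source.Ident_hom[OF Y] ArrMap_Ident[OF Y] source.Comp_Ident_right[OF v] over by simp
  ultimately have ab: "a \<cdot> b = Ident (Total p) Y"
    using cartesianD[OF cv v v, of "Ident (Base p) A"] I fI f over by auto
  show ?thesis
    unfolding isomorphic_def iso_in_def Bex_def fiber_hom_iff fiber_simps using a b ab ba by blast
qed

lemma Lift_props:
  assumes f: "f \<in> hom (Base p) A B" and X: "X \<in> Obj (fiber p B)"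
  shows "Lift p f X \<in> hom (Total p) (pullback f X) X"
    and "pr (Lift p f X) = f"
    and "cartesian p (Lift p f X)"
    and "pullback f X \<in> Obj (fiber p A)"
proof -
  have X': "X \<in> Obj (Total p)" "pob X = B"
    using X by (auto simp: fiber_simps)
  show l: "Lift p f X \<in> hom (Total p) (pullback f X) X" and pl: "pr (Lift p f X) = f"
    and "cartesian p (Lift p f X)"
    using Lift_over[OF f X'] Lift_cartesian[OF f X'] by (auto simp: hom_def reindex_def)
  show "pullback f X \<in> Obj (fiber p A)"
    using ArrMap_hom[OF l] pl f source.hom_Obj[OF l] by (auto simp: fiber_simps hom_def)
qed

text \<open>With \<open>u\<close> the given vertical isomorphism,
  \<open>u \<cdot> Lift p f X\<close> and \<open>Lift p f Y\<close> are Cartesian over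
  \<open>f\<close> with common codomain \<open>Y\<close>. This avoids the description of
  \<open>reindex\<close> on arrows.\<close>

lemma pullback_isomorphic:
  assumes f: "f \<in> hom (Base p) A B" and X: "X \<in> Obj (fiber p B)" and Y: "Y \<in> Obj (fiber p B)"
    and iso: "isomorphic (fiber p B) X Y"
  shows "isomorphic (fiber p A) (pullback f X) (pullback f Y)"
proof -
  obtain u where u: "iso_in (fiber p B) X Y u"
    using iso unfolding isomorphic_def by blast
  then have uh: "u \<in> hom (Total p) X Y" "pr u = Ident (Base p) B"
    unfolding iso_in_def fiber_hom_iff by auto
  have B: "B \<in> Obj (Base p)" using f target.hom_Obj by blast
  note LX = Lift_props[OF f X] and LY = Lift_props[OF f Y]
  show ?thesis
  proof (rule cartesian_domains_isomorphic)
    show "cartesian p (u \<cdot> Lift p f X)"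
      using cartesian_Comp[OF fiber_iso_cartesian[OF B u] LX(3) uh(1) LX(1)] .
    show "u \<cdot> Lift p f X \<in> hom (Total p) (pullback f X) Y"
      using source.Comp_hom[OF LX(1) uh(1)] .
    show "pr (u \<cdot> Lift p f X) = f"
      using ArrMap_Comp[OF LX(1) uh(1)] LX(2) uh(2) target.Comp_Ident_left[OF f] by simp
  qed (use LY f in blast)+
qed

text \<open>The composite of the two chosen liftings is Cartesian over
  \<open>g \<circ>\<^sub>B f\<close>. As the cleavage need not be split, it is compared with the
  chosen lifting only up to isomorphism.\<close>

lemma pullback_Comp:
  assumes f: "f \<in> hom (Base p) A B" and g: "g \<in> hom (Base p) B D" and X: "X \<in> Obj (fiber p D)"
  shows "isomorphic (fiber p A) (pullback (g \<circ>\<^sub>B f) X) (pullback f (pullback g X))"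
proof -
  have gf: "g \<circ>\<^sub>B f \<in> hom (Base p) A D"
    using target.Comp_hom[OF f g] .
  note Lg = Lift_props[OF g X] and Lgf = Lift_props[OF gf X]
  note Lf = Lift_props[OF f Lg(4)]
  show ?thesis
    by (rule cartesian_domains_isomorphic
        [OF Lgf(3) cartesian_Comp[OF Lg(3) Lf(3) Lg(1) Lf(1)] Lgf(1)
          source.Comp_hom[OF Lf(1) Lg(1)] gf Lgf(2)])
      (use ArrMap_Comp[OF Lf(1) Lg(1)] Lg Lf in simp)
qed

section \<open>The relation on morphisms induced by reindexing objects\<close>

text \<open>An objectwise weakening of weak equality: no naturality is asked for, and the morphisms
  themselves replace their graphs. Domain and codomain are explicit because they fix the
  fibers.\<close>

definition same_pullbacks where
  "same_pullbacks A B f f' \<longleftrightarrow> f \<in> hom (Base p) A B \<and> f' \<in> hom (Base p) A B \<and>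
    (\<forall>X \<in> Obj (fiber p B). isomorphic (fiber p A) (pullback f X) (pullback f' X))"

lemma same_pullbacks_trans:
  assumes "same_pullbacks A B f g" "same_pullbacks A B g h"
  shows "same_pullbacks A B f h"
proof -
  interpret F: category "fiber p A"
    using assms fiber_category target.hom_Obj unfolding same_pullbacks_def by blast
  show ?thesis
    using assms F.isomorphic_trans unfolding same_pullbacks_def by blast
qed

text \<open>Reindexing along \<open>g \<circ>\<^sub>B f\<close> is, up to isomorphism, reindexing
  along \<open>g\<close> and then \<open>f\<close>, and the hypothesis on \<open>f\<close> and
  \<open>f'\<close> covers the object \<open>pullback g X\<close>.\<close>

lemma same_pullbacks_Comp:
  assumes e: "same_pullbacks A B f f'" and g: "g \<in> hom (Base p) B D"
  shows "same_pullbacks A D (g \<circ>\<^sub>B f) (g \<circ>\<^sub>B f')"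
proof -
  have f: "f \<in> hom (Base p) A B" and f': "f' \<in> hom (Base p) A B"
    using e by (auto simp: same_pullbacks_def)
  interpret F: category "fiber p A"
    using fiber_category target.hom_Obj f by blast
  have "isomorphic (fiber p A) (pullback (g \<circ>\<^sub>B f) X) (pullback (g \<circ>\<^sub>B f') X)"
    if X: "X \<in> Obj (fiber p D)" for X
  proof -
    have "isomorphic (fiber p A) (pullback f (pullback g X)) (pullback f' (pullback g X))"
      using e Lift_props(4)[OF g X] by (simp add: same_pullbacks_def)
    then show ?thesis
      using pullback_Comp[OF f g X] pullback_Comp[OF f' g X] F.isomorphic_trans F.isomorphic_sym
      by blast
  qed
  then show ?thesis
    using f f' g target.Comp_hom unfolding same_pullbacks_def by blast
qed

end

section \<open>Consequences of the code structure and the diagonal argument\<close>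

context fibration_with_codes
begin

text \<open>Weak equality speaks of graphs; the second projection composed with the graph of
  \<open>f\<close> is \<open>f\<close> again, so postcomposing with it descends to the
  morphisms.\<close>

lemma weakly_equal_same_pullbacks:
  assumes w: "weakly_equal p Q f f'" and f: "f \<in> hom (Base p) A B"
  shows "same_pullbacks A B f f'"
proof -
  let ?I = "Ident (Base p) A"
  have AB: "A \<in> Obj (Base p)" "B \<in> Obj (Base p)"
    using f target.hom_Obj by blast+
  from w f have f': "f' \<in> hom (Base p) A B"
    and n: "naturally_isomorphic (fiber p (Prod Q A B)) (fiber p A)
        (reindex p (pairing (Base p) Q ?I f)) (reindex p (pairing (Base p) Q ?I f'))"
    unfolding weakly_equal_def by (auto simp: hom_def)
  note I = target.Ident_hom[OF AB(1)]
  note pf = pairing_props[OF I f] and pf' = pairing_props[OF I f']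
  \<comment> \<open>Only the components of the natural isomorphism are kept.\<close>
  have "same_pullbacks A (Prod Q A B) (pairing (Base p) Q ?I f) (pairing (Base p) Q ?I f')"
    using pf pf' n unfolding same_pullbacks_def naturally_isomorphic_def isomorphic_def by blast
  from same_pullbacks_Comp[OF this Proj2_hom[OF AB]] show ?thesis
    using pf pf' by simp
qed

text \<open>One component is replaced at a time. Global elements matter here: the component held
  fixed extends to a constant morphism.\<close>

lemma same_pullbacks_pairing:
  assumes a: "same_pullbacks (One Q) A a a'" and b: "same_pullbacks (One Q) B b b'"
  shows "same_pullbacks (One Q) (Prod Q A B) (pairing (Base p) Q a b) (pairing (Base p) Q a' b')"
proof -
  have ah: "a \<in> hom (Base p) (One Q) A" "a' \<in> hom (Base p) (One Q) A"
    and bh: "b \<in> hom (Base p) (One Q) B" "b' \<in> hom (Base p) (One Q) B"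
    using a b by (auto simp: same_pullbacks_def)
  have "same_pullbacks (One Q) (Prod Q A B) (pairing (Base p) Q a b) (pairing (Base p) Q a' b)"
    using same_pullbacks_Comp[OF a pairing_factor_left(2)[OF ah(1) bh(1)]]
      pairing_factor_left(1)[OF ah(1) bh(1)] pairing_factor_left(1)[OF ah(2) bh(1)] by simp
  moreover have
    "same_pullbacks (One Q) (Prod Q A B) (pairing (Base p) Q a' b) (pairing (Base p) Q a' b')"
    using same_pullbacks_Comp[OF b pairing_factor_right(2)[OF ah(2) bh(1)]]
      pairing_factor_right(1)[OF ah(2) bh(1)] pairing_factor_right(1)[OF ah(2) bh(2)] by simp
  ultimately show ?thesis
    by (rule same_pullbacks_trans)
qed

lemma fixed_point:
  assumes A: "A \<in> Obj (Base p)" and i: "i \<in> hom (Base p) (CodeFib K A) A"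
    and surj: "essentially_surjective (fiber p A) (fiber p (CodeFib K A)) (reindex p i)"
    and P: "P \<in> Obj (fiber p (CodeFib K (One Q)))"
  shows "\<exists>X \<in> Obj (fiber p (One Q)). isomorphic (fiber p (One Q)) (pullback (QuoteObj K X) P) X"
proof -
  define E where "E = CodeFib K A"
  define pair where "pair = pairing (Base p) Q"
  have E: "E \<in> Obj (Base p)" and i': "i \<in> hom (Base p) E A"
    using CodeFib_Obj[OF A] i by (auto simp: E_def)
  note One = One_Obj
  note qi = QuoteArr_hom[OF i']
  \<comment> \<open>In terms of elements, \<open>r\<close> sends \<open>x\<close> to
    \<open>app(x, <i>)\<close>, with \<open><i>\<close> the code of \<open>i\<close> supplied as a
    constant; \<open>d\<close> then applies the result to the code of \<open>x\<close>
    itself.\<close>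
  define r where "r = App K E A \<circ>\<^sub>B
    pair (Ident (Base p) E) (QuoteArr K i \<circ>\<^sub>B terminal_arr E)"
  define d where "d = App K (One Q) E \<circ>\<^sub>B pair r (Code K A)"
  have appE: "App K E A \<in> hom (Base p) (Prod Q E (CodeHom K E A)) (CodeFib K E)"
    using App_hom[OF E A] by (simp add: E_def)
  note app1 = App_hom[OF One E]
  have code: "Code K A \<in> hom (Base p) E (CodeHom K (One Q) E)"
    using Code_hom[OF A] by (simp add: E_def)
  have id_pair: "pair (Ident (Base p) E) (QuoteArr K i \<circ>\<^sub>B terminal_arr E)
      \<in> hom (Base p) E (Prod Q E (CodeHom K E A))"
    unfolding pair_def
    using pairing_props(1)[OF target.Ident_hom[OF E] target.Comp_hom[OF terminal_arr_hom[OF E] qi]] .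
  have r: "r \<in> hom (Base p) E (CodeFib K E)"
    unfolding r_def using target.Comp_hom[OF id_pair appE] .
  have rc: "pair r (Code K A) \<in> hom (Base p) E (Prod Q (CodeFib K E) (CodeHom K (One Q) E))"
    unfolding pair_def using pairing_props(1)[OF r code] .
  have d: "d \<in> hom (Base p) E (CodeFib K (One Q))"
    unfolding d_def using target.Comp_hom[OF rc app1] .
  obtain G where G: "G \<in> Obj (fiber p A)"
    and GP: "isomorphic (fiber p E) (pullback i G) (pullback d P)"
    using surj Lift_props(4)[OF d P] unfolding essentially_surjective_def E_def by blast
  define q where "q = QuoteObj K G"
  have q: "q \<in> hom (Base p) (One Q) E"
    unfolding q_def E_def using QuoteObj_hom[OF A G] .
  note Gi = Lift_props(4)[OF i' G]
  define X where "X = pullback q (pullback i G)"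
  have X: "X \<in> Obj (fiber p (One Q))"
    unfolding X_def using Lift_props(4)[OF q Gi] .

  have rq: "r \<circ>\<^sub>B q = App K E A \<circ>\<^sub>B pair q (QuoteArr K i)"
    unfolding r_def using target.Comp_assoc[OF q id_pair appE] pairing_factor_left(1)[OF q qi]
    by (simp add: pair_def)
  have dq: "d \<circ>\<^sub>B q = App K (One Q) E \<circ>\<^sub>B pair (r \<circ>\<^sub>B q) (Code K A \<circ>\<^sub>B q)"
    unfolding d_def using target.Comp_assoc[OF q rc app1] pairing_Comp[OF r code q]
    by (simp add: pair_def)
  \<comment> \<open>At the code \<open>q\<close> of \<open>G\<close>, \<open>r\<close> yields the
    code of \<open>G . i\<close>, up to the relation.\<close>
  have r_eq: "same_pullbacks (One Q) (CodeFib K E) (r \<circ>\<^sub>B q) (QuoteObj K (pullback i G))"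
    using weakly_equal_same_pullbacks[OF _ target.Comp_hom[OF q r]] App_weak[OF i' G] rq
    by (simp add: pair_def q_def)
  have code_eq: "same_pullbacks (One Q) (CodeHom K (One Q) E) (Code K A \<circ>\<^sub>B q) (QuoteArr K q)"
    using weakly_equal_same_pullbacks[OF _ target.Comp_hom[OF q code]] Code_weak[OF A G]
    by (simp add: q_def)
  have "same_pullbacks (One Q) (CodeFib K (One Q)) (d \<circ>\<^sub>B q)
      (App K (One Q) E \<circ>\<^sub>B pair (QuoteObj K (pullback i G)) (QuoteArr K q))"
    unfolding dq pair_def
    using same_pullbacks_Comp[OF same_pullbacks_pairing[OF r_eq code_eq] app1] .
  \<comment> \<open>The law for \<open>App\<close> is now used with the morphism \<open>q\<close>,
    itself a code, acting on \<open>pullback i G\<close>. The coded result is \<open>X\<close> by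
    the definition of \<open>X\<close>.\<close>
  moreover have "same_pullbacks (One Q) (CodeFib K (One Q))
      (App K (One Q) E \<circ>\<^sub>B pair (QuoteObj K (pullback i G)) (QuoteArr K q)) (QuoteObj K X)"
    unfolding X_def pair_def
    by (rule weakly_equal_same_pullbacks[OF App_weak[OF q Gi]])
      (rule target.Comp_hom[OF pairing_props(1)[OF QuoteObj_hom[OF E Gi] QuoteArr_hom[OF q]] app1])
  ultimately have "same_pullbacks (One Q) (CodeFib K (One Q)) (d \<circ>\<^sub>B q) (QuoteObj K X)"
    by (rule same_pullbacks_trans)
  then have dX: "isomorphic (fiber p (One Q)) (pullback (d \<circ>\<^sub>B q) P) (pullback (QuoteObj K X) P)"
    using P by (simp add: same_pullbacks_def)

  interpret F: category "fiber p (One Q)"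
    using fiber_category[OF One] .
  \<comment> \<open>Reindexing the isomorphism that defines \<open>G\<close> along \<open>q\<close>
    starts the chain from \<open>X\<close> through \<open>P . d . q\<close> and
    \<open>P . (d q)\<close> to \<open>P . <X>\<close>, where \<open><X>\<close> is the code of
    \<open>X\<close>.\<close>
  have "isomorphic (fiber p (One Q)) X (pullback q (pullback d P))"
    unfolding X_def using pullback_isomorphic[OF q Gi Lift_props(4)[OF d P] GP] .
  then have "isomorphic (fiber p (One Q)) X (pullback (QuoteObj K X) P)"
    using pullback_Comp[OF q d P] dX F.isomorphic_trans F.isomorphic_sym by blast
  then show ?thesis
    using X F.isomorphic_sym by blast
qed

end

theorem theorem3p14:
  fixes p :: "('e, 'a, 'o, 'm) fibration_data"
    and Q :: "('o, 'm) products_data"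
    and K :: "('e, 'o, 'm) code_data"
  assumes "fibration_with_codes p Q K"
    and "\<exists>A i. A \<in> Obj (Base p) \<and> i \<in> hom (Base p) (CodeFib K A) A \<and>
          essentially_surjective (fiber p A) (fiber p (CodeFib K A)) (reindex p i)"
  shows "\<forall>P \<in> Obj (fiber p (CodeFib K (One Q))).
          \<exists>X \<in> Obj (fiber p (One Q)).
            isomorphic (fiber p (One Q)) (ObjMap (reindex p (QuoteObj K X)) P) X"
proof -
  interpret fibration_with_codes p Q K
    by (fact assms(1))
  show ?thesis
    using assms(2) fixed_point by blast
qed

end
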